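(* Let $H=(V,E)$ be a hypergraph. If some shadow $G$ of $H$ is an odd cycle (i.e. $G=C_{2n+1}$ for some positive integer $n$), then $\mathfrak p_V\in \operatorname{ass}(J(H)^2)$.
   Context: Let $K$ be a field. A hypergraph $H=(V,E)$ is a finite simple hypergraph (clutter): $V=\{x_1,\dots,x_n\}$ is a finite set of vertices, regarded as variables of the polynomial ring $K[V]=K[x_1,\dots,x_n]$, and $E$ is a collection of subsets of $V$ (edges), none of which is contained in another. For $U\subseteq V$, $\mathfrak p_U\subseteq K[V]$ is the prime ideal generated by the variables in $U$. The cover ideal of $H$ is $J(H)=\bigcap_{e\in E}\mathfrak p_e\subseteq K[V]$. For an ideal $I$ of a ring $R$, $\operatorname{ass}(I)$ is the set of associated primes of $I$, that is, the prime ideals of $R$ of the form $\operatorname{Ann}(m)$ for some $m\in R/I$. A hypergraph $H'=(V',E')$ (itself simple) is a shadow of $H=(V,E)$ if $V'\subseteq V$, $E'=\{e\cap V' : e\in E\}$ and $|E'|=|E|$. The cycle graph $C_{2n+1}$ ($n\ge 1$) has $2n+1$ distinct vertices, which can be labelled $x_1,\dots,x_{2n+1}$ so that its edges are $\{x_i,x_{i+1}\}$ for $1\le i\le 2n$ together with $\{x_{2n+1},x_1\}$.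
   Formalization: The formal theorem also assumes that every vertex of H lies in some edge; with an isolated vertex z the claim is false (e.g. a triangle plus z), since z is a nonzerodivisor modulo J(H)^2, so p_V is never an associated prime. *)

theory Defs
  imports "HOL-Library.Poly_Mapping" "HOL-Algebra.QuotRing" "HOL-Algebra.Ideal_Product"
begin

section \<open>The polynomial ring over a field in the variables \<open>V\<close>\<close>

text \<open>
  A monomial is a finitely supported exponent vector \<open>'v \<Rightarrow>\<^sub>0 nat\<close> and a polynomial is a
  finitely supported coefficient function on monomials; \<open>+\<close> and \<open>*\<close> on \<open>\<Rightarrow>\<^sub>0\<close> are
  pointwise addition and convolution.  The polynomials in the variables from \<open>V\<close> are those
  whose monomials only involve elements of \<open>V\<close>; they are packaged as a ring record in order
  to use the ideal theory of HOL-Algebra.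
\<close>

definition mpoly_ring :: "'v set \<Rightarrow> (('v \<Rightarrow>\<^sub>0 nat) \<Rightarrow>\<^sub>0 'k::field) ring" where
  "mpoly_ring V =
    \<lparr> carrier = {p. \<forall>m \<in> Poly_Mapping.keys p. Poly_Mapping.keys m \<subseteq> V},
      mult = (*), one = 1, zero = 0, add = (+) \<rparr>"

definition mpoly_var :: "'v \<Rightarrow> (('v \<Rightarrow>\<^sub>0 nat) \<Rightarrow>\<^sub>0 'k::field)" where
  "mpoly_var x = Poly_Mapping.single (Poly_Mapping.single x 1) 1"

lemma cring_mpoly_ring: "cring (mpoly_ring V :: (('v \<Rightarrow>\<^sub>0 nat) \<Rightarrow>\<^sub>0 'k::field) ring)"
proof (rule cringI)
  let ?R = "mpoly_ring V :: (('v \<Rightarrow>\<^sub>0 nat) \<Rightarrow>\<^sub>0 'k) ring"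
  have add_closed: "p + q \<in> carrier ?R" if "p \<in> carrier ?R" "q \<in> carrier ?R" for p q
    using that keys_add[of p q] unfolding mpoly_ring_def by auto
  have mult_closed: "p * q \<in> carrier ?R" if pq: "p \<in> carrier ?R" "q \<in> carrier ?R" for p q
  proof -
    have "Poly_Mapping.keys m \<subseteq> V" if m: "m \<in> Poly_Mapping.keys (p * q)" for m
    proof -
      obtain a b where "m = a + b" "a \<in> Poly_Mapping.keys p" "b \<in> Poly_Mapping.keys q"
        using m keys_mult[of p q] by blast
      moreover from this have "Poly_Mapping.keys a \<subseteq> V" "Poly_Mapping.keys b \<subseteq> V"
        using pq by (simp_all add: mpoly_ring_def)
      ultimately show ?thesis
        using keys_add[of a b] by blast
    qed
    then show ?thesis
      unfolding mpoly_ring_def by simp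
  qed
  show "abelian_group ?R"
  proof (rule abelian_groupI)
    fix p assume "p \<in> carrier ?R"
    moreover have "Poly_Mapping.keys (- p) = Poly_Mapping.keys p"
      by (simp add: set_eq_iff in_keys_iff)
    ultimately have "- p \<in> carrier ?R"
      by (simp add: mpoly_ring_def)
    then show "\<exists>q \<in> carrier ?R. q \<oplus>\<^bsub>?R\<^esub> p = \<zero>\<^bsub>?R\<^esub>"
      by (intro bexI[of _ "- p"]) (simp_all add: mpoly_ring_def)
  next
    show "p \<oplus>\<^bsub>?R\<^esub> q \<in> carrier ?R" if "p \<in> carrier ?R" "q \<in> carrier ?R" for p q
      using add_closed[OF that] by (simp add: mpoly_ring_def)
  qed (simp_all add: mpoly_ring_def ac_simps)
  show "comm_monoid ?R"
  proof (rule comm_monoidI)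
    show "p \<otimes>\<^bsub>?R\<^esub> q \<in> carrier ?R" if "p \<in> carrier ?R" "q \<in> carrier ?R" for p q
      using mult_closed[OF that] by (simp add: mpoly_ring_def)
  qed (simp_all add: mpoly_ring_def ac_simps)
qed (simp add: mpoly_ring_def distrib_right)

section \<open>Associated primes\<close>

definition Ann_quot :: "('a, 'b) ring_scheme \<Rightarrow> 'a set \<Rightarrow> 'a set \<Rightarrow> 'a set" where
  "Ann_quot R I m =
    {r \<in> carrier R. (I +>\<^bsub>R\<^esub> r) \<otimes>\<^bsub>R Quot I\<^esub> m = \<zero>\<^bsub>R Quot I\<^esub>}"

definition ass :: "('a, 'b) ring_scheme \<Rightarrow> 'a set \<Rightarrow> 'a set set" where
  "ass R I = {P. primeideal P R \<and> (\<exists>m \<in> carrier (R Quot I). P = Ann_quot R I m)}"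

section \<open>Hypergraphs, shadows and odd cycles\<close>

definition hypergraph :: "'v set \<Rightarrow> 'v set set \<Rightarrow> bool" where
  "hypergraph V E \<longleftrightarrow>
    finite V \<and> (\<forall>e \<in> E. e \<subseteq> V) \<and> (\<forall>e \<in> E. \<forall>f \<in> E. e \<subseteq> f \<longrightarrow> e = f)"

definition shadow :: "'v set \<Rightarrow> 'v set set \<Rightarrow> 'v set \<Rightarrow> 'v set set \<Rightarrow> bool" where
  "shadow V' E' V E \<longleftrightarrow>
    hypergraph V' E' \<and> V' \<subseteq> V \<and> E' = {e \<inter> V' | e. e \<in> E} \<and> card E' = card E"

definition odd_cycle :: "nat \<Rightarrow> 'v set \<Rightarrow> 'v set set \<Rightarrow> bool" where
  "odd_cycle n V E \<longleftrightarrow>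
    (\<exists>x :: nat \<Rightarrow> 'v. bij_betw x {1..2*n+1} V \<and>
      E = {{x i, x (i+1)} | i. 1 \<le> i \<and> i \<le> 2*n} \<union> {{x (2*n+1), x 1}})"

section \<open>The cover ideal\<close>

definition var_ideal :: "'v set \<Rightarrow> 'v set \<Rightarrow> (('v \<Rightarrow>\<^sub>0 nat) \<Rightarrow>\<^sub>0 'k::field) set" where
  "var_ideal V U = Idl\<^bsub>mpoly_ring V\<^esub> (mpoly_var ` U)"

text \<open>Intersecting with the carrier only matters for \<open>E = {}\<close>, where the empty intersection
  of ideals is the whole ring.\<close>

definition cover_ideal :: "'v set \<Rightarrow> 'v set set \<Rightarrow> (('v \<Rightarrow>\<^sub>0 nat) \<Rightarrow>\<^sub>0 'k::field) set" where
  "cover_ideal V E = carrier (mpoly_ring V) \<inter> (\<Inter>e \<in> E. var_ideal V e)"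

end

theory Submission
  imports Defs
begin

text \<open>
  Let \<open>V'\<close> be the vertex set of the odd cycle and let \<open>m\<close> be the product of the variables in
  \<open>V'\<close>.  Then \<open>J\<^sup>2 : m\<close> is the maximal ideal \<open>p\<^sub>V\<close>.  If \<open>m\<close> were in \<open>J\<^sup>2\<close>, then \<open>V'\<close> would split
  into two disjoint covers of the cycle, i.e. the cycle would be bipartite.  Conversely, a
  vertex \<open>v \<in> V\<close> lies on some edge \<open>e\<close>; deleting the corresponding edge from the cycle makes it
  a path, so \<open>V' = A \<union> B\<close> where \<open>A\<close> is a cover and \<open>B\<close> meets every edge except possibly \<open>e\<close>.
  Thus \<open>A\<close> and \<open>B \<union> {v}\<close> are covers, whence \<open>v m \<in> J\<^sup>2\<close>.
\<close>

section \<open>Odd cycles and bipartitions\<close>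

text \<open>Otherwise membership in \<open>A\<close> flips along every edge. From \<open>x 1\<close>
  to \<open>x (2*n+1)\<close> there are evenly many flips, so the closing edge has both ends on the
  same side.\<close>

lemma odd_cycle_not_bipartite:
  assumes "odd_cycle n V E"
  shows "\<exists>e\<in>E. e \<inter> A = {} \<or> e \<subseteq> A"
proof (rule ccontr)
  assume "\<not> (\<exists>e\<in>E. e \<inter> A = {} \<or> e \<subseteq> A)"
  then have no: "e \<inter> A \<noteq> {} \<and> \<not> e \<subseteq> A" if "e \<in> E" for e
    using that by blast
  obtain x where E: "E = {{x i, x (i+1)} | i. 1 \<le> i \<and> i \<le> 2*n} \<union> {{x (2*n+1), x 1}}"
    using assms unfolding odd_cycle_def by blast
  have step: "x (i+1) \<in> A \<longleftrightarrow> x i \<notin> A" if "1 \<le> i" "i \<le> 2*n" for i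
  proof -
    have "{x i, x (i+1)} \<in> E" using that E by blast
    from no[OF this] show ?thesis by auto
  qed
  have "i \<le> 2*n \<Longrightarrow> x (i+1) \<in> A \<longleftrightarrow> (even i \<longleftrightarrow> x 1 \<in> A)" for i
  proof (induction i)
    case (Suc i)
    then show ?case using step[of "Suc i"] by auto
  qed simp
  from this[of "2*n"] have "x (2*n+1) \<in> A \<longleftrightarrow> x 1 \<in> A" by simp
  moreover have "{x (2*n+1), x 1} \<in> E" using E by blast
  then have "{x (2*n+1), x 1} \<inter> A \<noteq> {} \<and> \<not> {x (2*n+1), x 1} \<subseteq> A" by (rule no)
  ultimately show False by simp
qed

text \<open>Without \<open>f\<close> the cycle is a path with \<open>2*n\<close> edges. An
  alternating choice that starts inside \<open>A\<close> also ends inside \<open>A\<close>, so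
  \<open>A\<close> contains \<open>f\<close> and no other edge.\<close>

lemma odd_cycle_delete_edge_bipartite:
  assumes "odd_cycle n V E" and "f \<in> E"
  obtains A where "A \<subseteq> V" "\<And>e. e \<in> E \<Longrightarrow> e \<inter> A \<noteq> {}"
    "\<And>e. e \<in> E \<Longrightarrow> e \<noteq> f \<Longrightarrow> \<not> e \<subseteq> A"
proof -
  obtain x where bij: "bij_betw x {1..2*n+1} V"
    and E: "E = {{x i, x (i+1)} | i. 1 \<le> i \<and> i \<le> 2*n} \<union> {{x (2*n+1), x 1}}"
    using assms(1) unfolding odd_cycle_def by blast
  have inj: "inj_on x {1..2*n+1}"
    using bij by (rule bij_betw_imp_inj_on)
  \<comment> \<open>The path left after deleting \<open>f\<close> starts at \<open>x i\<close>;
    \<open>i = 1\<close> is the case of the closing edge.\<close>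
  obtain i where i: "1 \<le> i" "i \<le> 2*n+1"
    and f: "f = (if i = 1 then {x (2*n+1), x 1} else {x (i-1), x i})"
  proof -
    consider j where "1 \<le> j" "j \<le> 2*n" "f = {x j, x (j+1)}" | "f = {x (2*n+1), x 1}"
      using assms(2) E by blast
    then show thesis
    proof cases
      case (1 j)
      then show thesis by (intro that[of "j + 1"]) simp_all
    next
      case 2
      then show thesis by (intro that[of 1]) simp_all
    qed
  qed
  \<comment> \<open>These are the vertices at even distance from \<open>x i\<close> along the path.
    For \<open>k < i\<close> that distance is \<open>k + 2*n + 1 - i\<close>, and the odd
    wrap-around reverses the parity test.\<close>
  define A where "A = x ` {k \<in> {1..2*n+1}. even (i + k) \<longleftrightarrow> i \<le> k}"
  have mem: "x k \<in> A \<longleftrightarrow> (even (i + k) \<longleftrightarrow> i \<le> k)" if "k \<in> {1..2*n+1}" for k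
    unfolding A_def using that by (subst inj_on_image_mem_iff[OF inj]) auto
  have edges: "e \<inter> A \<noteq> {} \<and> (e \<noteq> f \<longrightarrow> \<not> e \<subseteq> A)" if e: "e \<in> E" for e
  proof -
    consider j where "1 \<le> j" "j \<le> 2*n" "e = {x j, x (j+1)}" | "e = {x (2*n+1), x 1}"
      using e E by blast
    then show ?thesis
    proof cases
      case (1 j)
      then have m: "x j \<in> A \<longleftrightarrow> (even (i + j) \<longleftrightarrow> i \<le> j)"
        "x (j+1) \<in> A \<longleftrightarrow> (odd (i + j) \<longleftrightarrow> i \<le> j + 1)"
        using mem[of j] mem[of "j+1"] by simp_all
      show ?thesis
      proof (cases "i = j + 1")
        case True
        then have "e = f" "x (j+1) \<in> A" using 1 m(2) f by simp_all
        then show ?thesis using 1(3) by blast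
      next
        case False
        \<comment> \<open>Here \<open>j\<close> and \<open>j + 1\<close> lie on the same side of
          \<open>i\<close>, so only the parity flips.\<close>
        then have "i \<le> j + 1 \<longleftrightarrow> i \<le> j" by linarith
        then have "x (j+1) \<in> A \<longleftrightarrow> x j \<notin> A" using m by blast
        then show ?thesis unfolding 1(3) by blast
      qed
    next
      case 2
      \<comment> \<open>The indices \<open>1\<close> and \<open>2*n+1\<close> have equal parity; for
        \<open>i \<noteq> 1\<close> they lie on different sides of \<open>i\<close>, which makes the
        two memberships opposite.\<close>
      have m: "x (2*n+1) \<in> A \<longleftrightarrow> odd i" "x 1 \<in> A \<longleftrightarrow> (odd i \<longleftrightarrow> i = 1)"
        using mem[of "2*n+1"] mem[of 1] i by auto
      show ?thesis
      proof (cases "i = 1")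
        case True
        then have "e = f" "x 1 \<in> A" using 2 m(2) f by simp_all
        then show ?thesis using 2 by blast
      next
        case False
        then have "x 1 \<in> A \<longleftrightarrow> x (2*n+1) \<notin> A" using m by blast
        then show ?thesis unfolding 2 by blast
      qed
    qed
  qed
  have "A \<subseteq> V"
    using bij by (auto simp: A_def bij_betw_def)
  with edges show thesis by (intro that[of A]) blast+
qed

section \<open>Colon ideals and annihilators\<close>

text \<open>Since the colon is an ideal, it contains \<open>var_ideal V V\<close> as soon as it
  contains the variables.\<close>

lemma (in cring) colon_ideal:
  assumes "ideal I R" and a: "a \<in> carrier R"
  shows "ideal {r \<in> carrier R. r \<otimes> a \<in> I} R"
proof -
  interpret I: ideal I R by fact
  show ?thesis
  proof (rule idealI[OF ring_axioms])
    show "subgroup {r \<in> carrier R. r \<otimes> a \<in> I} (add_monoid R)"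
    proof (rule add.subgroupI)
      show "{r \<in> carrier R. r \<otimes> a \<in> I} \<noteq> {}"
        using a by (auto intro!: exI[of _ \<zero>])
    qed (use a in \<open>auto simp: l_distr l_minus simp flip: a_inv_def\<close>)
  next
    fix r s assume "r \<in> {r \<in> carrier R. r \<otimes> a \<in> I}" "s \<in> carrier R"
    then show "s \<otimes> r \<in> {r \<in> carrier R. r \<otimes> a \<in> I}"
      using a by (auto simp: m_assoc I.I_l_closed)
    then show "r \<otimes> s \<in> {r \<in> carrier R. r \<otimes> a \<in> I}"
      using \<open>r \<in> _\<close> \<open>s \<in> _\<close> by (simp add: m_comm)
  qed
qed

text \<open>Cosets multiply to \<open>I +> (r \<otimes> a)\<close>, which is zero exactly when
  \<open>r \<otimes> a\<close> lies in \<open>I\<close>. Annihilators thus become colon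
  ideals.\<close>

lemma (in cring) Ann_quot_coset:
  assumes "ideal I R" and "a \<in> carrier R"
  shows "Ann_quot R I (I +> a) = {r \<in> carrier R. r \<otimes> a \<in> I}"
proof -
  interpret I: ideal I R by fact
  have "I +> (r \<otimes> a) = I \<longleftrightarrow> r \<otimes> a \<in> I" if "r \<in> carrier R" for r
    using that assms(2) a_rcos_zero[OF assms(1)] I.rcos_const_imp_mem[OF m_closed] by blast
  then show ?thesis
    using assms(2) by (simp add: Ann_quot_def FactRing_def I.rcoset_mult_add cong: conj_cong)
qed

section \<open>Monomial ideals\<close>

lemma carrier_mpoly_ring:
  "p \<in> carrier (mpoly_ring V) \<longleftrightarrow> (\<forall>k\<in>Poly_Mapping.keys p. Poly_Mapping.keys k \<subseteq> V)"
  by (simp add: mpoly_ring_def)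

lemma mpoly_ring_simps:
  "mult (mpoly_ring V) p q = p * q" "add (mpoly_ring V) p q = p + q"
  "one (mpoly_ring V) = 1" "zero (mpoly_ring V) = 0"
  by (simp_all add: mpoly_ring_def)

lemma keys_add_nat [simp]:
  fixes a b :: "'a \<Rightarrow>\<^sub>0 nat"
  shows "Poly_Mapping.keys (a + b) = Poly_Mapping.keys a \<union> Poly_Mapping.keys b"
  by (auto simp: in_keys_iff lookup_add)

lemma poly_mapping_add_eq_0_iff:
  fixes a b :: "'a \<Rightarrow>\<^sub>0 nat"
  shows "a + b = 0 \<longleftrightarrow> a = 0 \<and> b = 0"
  by (auto simp: poly_mapping_eq_iff lookup_add fun_eq_iff)

text \<open>Turns the step of \<open>update_induct\<close> into the addition of one new term, to
  which ring laws apply.\<close>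

lemma update_eq_single_add:
  assumes "a \<notin> Poly_Mapping.keys f"
  shows "Poly_Mapping.update a b f = Poly_Mapping.single a b + f"
  using assms
  by (intro poly_mapping_eqI)
    (auto simp: lookup_update lookup_add lookup_single in_keys_iff when_def)

text \<open>The exponent \<open>0\<close> splits only as \<open>0 + 0\<close>. Multiplicativity of
  the constant term is what makes \<open>var_ideal V V\<close> prime.\<close>

lemma lookup_mult_0:
  fixes p q :: "('a \<Rightarrow>\<^sub>0 nat) \<Rightarrow>\<^sub>0 'k::field"
  shows "Poly_Mapping.lookup (p * q) 0 = Poly_Mapping.lookup p 0 * Poly_Mapping.lookup q 0"
proof -
  have "(\<Sum>b. Poly_Mapping.lookup q b when 0 = a + b) = (Poly_Mapping.lookup q 0 when a = 0)"
    for a :: "'a \<Rightarrow>\<^sub>0 nat"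
  proof -
    have *: "(\<lambda>b. Poly_Mapping.lookup q b when 0 = a + b)
        = (\<lambda>b. (Poly_Mapping.lookup q b when a = 0) when b = 0)"
      using poly_mapping_add_eq_0_iff[of a] by (intro ext) (auto simp: when_def)
    show ?thesis unfolding * by (rule Sum_any_when_equal)
  qed
  then show ?thesis by (simp add: lookup_mult mult_when)
qed

text \<open>Adding \<open>m\<close> to exponents is injective by cancellation, so distinct terms of
  \<open>p\<close> never merge.\<close>

lemma lookup_mult_single:
  fixes p :: "'a::cancel_comm_monoid_add \<Rightarrow>\<^sub>0 'k::comm_semiring_0"
  shows "Poly_Mapping.lookup (p * Poly_Mapping.single m c) (k + m) = Poly_Mapping.lookup p k * c"
proof (induction p rule: update_induct)
  case const
  then show ?case by simp
next
  case (update f a b)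
  then show ?case
    by (simp add: update_eq_single_add distrib_right lookup_add mult_single lookup_single
        when_mult)
qed

text \<open>Described by supports instead of generators, so that membership is tested monomial by
  monomial and intersections become conjunctions. It is an ideal when \<open>P\<close> is stable
  under adding exponents.\<close>

definition monomial_ideal ::
    "'v set \<Rightarrow> (('v \<Rightarrow>\<^sub>0 nat) \<Rightarrow> bool) \<Rightarrow> (('v \<Rightarrow>\<^sub>0 nat) \<Rightarrow>\<^sub>0 'k::field) set" where
  "monomial_ideal V P = {p \<in> carrier (mpoly_ring V). \<forall>k \<in> Poly_Mapping.keys p. P k}"

lemma ideal_monomial_ideal:
  assumes up: "\<And>k l. P k \<Longrightarrow> P (k + l)"
  shows "ideal (monomial_ideal V P :: (('v \<Rightarrow>\<^sub>0 nat) \<Rightarrow>\<^sub>0 'k::field) set) (mpoly_ring V)"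
proof -
  let ?R = "mpoly_ring V :: (('v \<Rightarrow>\<^sub>0 nat) \<Rightarrow>\<^sub>0 'k::field) ring"
  let ?I = "monomial_ideal V P :: (('v \<Rightarrow>\<^sub>0 nat) \<Rightarrow>\<^sub>0 'k::field) set"
  interpret cring ?R by (rule cring_mpoly_ring)
  \<comment> \<open>Negation in the ring record is identified with pointwise negation, which
    preserves supports.\<close>
  have inv: "\<ominus>\<^bsub>?R\<^esub> p = - p" if p: "p \<in> carrier ?R" for p
  proof -
    have "- p \<in> carrier ?R"
      using p by (simp add: carrier_mpoly_ring in_keys_iff)
    then show ?thesis
      using p by (intro minus_equality) (auto simp: mpoly_ring_simps)
  qed
  have mult: "q * p \<in> ?I" if "p \<in> ?I" "q \<in> carrier ?R" for p q
  proof -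
    have "q * p \<in> carrier ?R"
      using m_closed[of q p] that by (simp add: monomial_ideal_def mpoly_ring_simps)
    moreover have "P k" if "k \<in> Poly_Mapping.keys (q * p)" for k
    proof -
      obtain a b where "k = b + a" "b \<in> Poly_Mapping.keys p"
        using \<open>k \<in> _\<close> keys_mult[of q p] by (auto simp: add.commute)
      then show ?thesis
        using up \<open>p \<in> ?I\<close> by (simp add: monomial_ideal_def)
    qed
    ultimately show ?thesis by (simp add: monomial_ideal_def)
  qed
  show ?thesis
  proof (rule idealI[OF ring_axioms])
    show "subgroup ?I (add_monoid ?R)"
    proof (rule add.subgroupI)
      show "?I \<subseteq> carrier ?R"
        by (auto simp: monomial_ideal_def)
      have "0 \<in> ?I"
        by (simp add: monomial_ideal_def carrier_mpoly_ring)
      then show "?I \<noteq> {}" by blast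
      show "\<ominus>\<^bsub>?R\<^esub> p \<in> ?I" if "p \<in> ?I" for p
        using that inv[of p] by (auto simp: monomial_ideal_def carrier_mpoly_ring in_keys_iff)
      show "p \<oplus>\<^bsub>?R\<^esub> q \<in> ?I" if "p \<in> ?I" "q \<in> ?I" for p q
        using that keys_add[of p q]
        by (simp add: monomial_ideal_def carrier_mpoly_ring mpoly_ring_simps) blast
    qed
    show "q \<otimes>\<^bsub>?R\<^esub> p \<in> ?I" if "p \<in> ?I" "q \<in> carrier ?R" for p q
      using mult[OF that] by (simp add: mpoly_ring_simps)
    show "p \<otimes>\<^bsub>?R\<^esub> q \<in> ?I" if "p \<in> ?I" "q \<in> carrier ?R" for p q
      using mult[OF that] by (simp add: mpoly_ring_simps mult.commute)
  qed
qed

lemma mpoly_var_in_carrier: "U \<subseteq> V \<Longrightarrow> mpoly_var ` U \<subseteq> carrier (mpoly_ring V)"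
  by (auto simp: mpoly_var_def carrier_mpoly_ring)

lemma ideal_var_ideal:
  assumes "U \<subseteq> V"
  shows "ideal (var_ideal V U :: (('v \<Rightarrow>\<^sub>0 nat) \<Rightarrow>\<^sub>0 'k::field) set) (mpoly_ring V)"
proof -
  interpret cring "mpoly_ring V :: (('v \<Rightarrow>\<^sub>0 nat) \<Rightarrow>\<^sub>0 'k::field) ring"
    by (rule cring_mpoly_ring)
  show ?thesis
    unfolding var_ideal_def by (rule genideal_ideal[OF mpoly_var_in_carrier[OF assms]])
qed

text \<open>The variables in \<open>U\<close> satisfy the support condition; conversely each
  monomial satisfying it is divisible by such a variable, and polynomials are sums of their
  terms.\<close>

lemma var_ideal_eq_monomial_ideal:
  assumes "U \<subseteq> V"
  shows "(var_ideal V U :: (('v \<Rightarrow>\<^sub>0 nat) \<Rightarrow>\<^sub>0 'k::field) set)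
    = monomial_ideal V (\<lambda>k. Poly_Mapping.keys k \<inter> U \<noteq> {})" (is "?L = ?I")
proof
  let ?R = "mpoly_ring V :: (('v \<Rightarrow>\<^sub>0 nat) \<Rightarrow>\<^sub>0 'k::field) ring"
  interpret cring ?R by (rule cring_mpoly_ring)
  interpret L: ideal ?L ?R by (rule ideal_var_ideal[OF assms])
  have "ideal ?I ?R"
    by (rule ideal_monomial_ideal) auto
  moreover have "mpoly_var ` U \<subseteq> ?I"
    using assms by (auto simp: monomial_ideal_def mpoly_var_def carrier_mpoly_ring)
  ultimately show "?L \<subseteq> ?I"
    unfolding var_ideal_def by (rule genideal_minimal)
  have single: "Poly_Mapping.single k c \<in> ?L"
    if k: "Poly_Mapping.keys k \<subseteq> V" and "Poly_Mapping.keys k \<inter> U \<noteq> {}" for k and c :: 'k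
  proof -
    obtain x where x: "x \<in> Poly_Mapping.keys k" "x \<in> U"
      using \<open>Poly_Mapping.keys k \<inter> U \<noteq> {}\<close> by blast
    \<comment> \<open>Truncated subtraction is exact here because \<open>x\<close> occurs in
      \<open>k\<close>.\<close>
    define l where "l = k - Poly_Mapping.single x 1"
    have kl: "k = l + Poly_Mapping.single x 1"
      using x by (intro poly_mapping_eqI)
        (auto simp: l_def lookup_add lookup_minus lookup_single in_keys_iff when_def)
    have "mpoly_var x \<in> ?L"
      using genideal_self[OF mpoly_var_in_carrier[OF assms]] x unfolding var_ideal_def by blast
    moreover have "Poly_Mapping.single l c \<in> carrier ?R"
      using k kl by (auto simp: carrier_mpoly_ring)
    ultimately have "Poly_Mapping.single l c \<otimes>\<^bsub>?R\<^esub> mpoly_var x \<in> ?L"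
      by (rule L.I_l_closed)
    then show ?thesis by (simp add: mpoly_ring_simps mpoly_var_def mult_single kl)
  qed
  \<comment> \<open>The added exponent is fresh, so the support of \<open>f\<close> stays inside
    that of the update and the premise passes to \<open>f\<close>.\<close>
  have "p \<in> ?I \<longrightarrow> p \<in> ?L" for p
  proof (induction p rule: update_induct)
    case const
    then show ?case using L.zero_closed by (simp add: mpoly_ring_simps)
  next
    case (update f a b)
    show ?case
    proof
      assume "Poly_Mapping.update a b f \<in> ?I"
      moreover have "Poly_Mapping.keys (Poly_Mapping.update a b f)
          = insert a (Poly_Mapping.keys f)"
        using update by (simp add: keys_update)
      ultimately have "f \<in> ?I" "Poly_Mapping.single a b \<in> ?L"
        by (auto simp: monomial_ideal_def carrier_mpoly_ring intro!: single)
      then have "Poly_Mapping.single a b \<oplus>\<^bsub>?R\<^esub> f \<in> ?L"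
        using update by (intro L.a_closed) auto
      then show "Poly_Mapping.update a b f \<in> ?L"
        using update by (simp add: mpoly_ring_simps update_eq_single_add)
    qed
  qed
  then show "?I \<subseteq> ?L" by blast
qed

text \<open>An exponent vector supported in \<open>V\<close> misses \<open>V\<close> only if it is
  \<open>0\<close>, so the sole condition is on the constant term.\<close>

lemma var_ideal_all_iff:
  "p \<in> var_ideal V V \<longleftrightarrow> p \<in> carrier (mpoly_ring V) \<and> Poly_Mapping.lookup p 0 = 0"
proof -
  have "(Poly_Mapping.keys k \<inter> V \<noteq> {}) \<longleftrightarrow> k \<noteq> 0"
    if "Poly_Mapping.keys k \<subseteq> V" for k :: "'a \<Rightarrow>\<^sub>0 nat"
    using that by (auto simp: Int_absorb2)
  then show ?thesis
    unfolding var_ideal_eq_monomial_ideal[OF subset_refl] monomial_ideal_def carrier_mpoly_ring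
    by (auto simp: in_keys_iff) (metis lookup_not_eq_zero_eq_in_keys)+
qed

lemma primeideal_var_ideal:
  "primeideal (var_ideal V V :: (('v \<Rightarrow>\<^sub>0 nat) \<Rightarrow>\<^sub>0 'k::field) set) (mpoly_ring V)"
proof (rule primeidealI)
  let ?R = "mpoly_ring V :: (('v \<Rightarrow>\<^sub>0 nat) \<Rightarrow>\<^sub>0 'k::field) ring"
  interpret cring ?R by (rule cring_mpoly_ring)
  show "ideal (var_ideal V V) ?R" by (simp add: ideal_var_ideal)
  show "cring ?R" by (rule cring_mpoly_ring)
  have "1 \<in> carrier ?R" using one_closed by (simp add: mpoly_ring_simps)
  moreover have "1 \<notin> (var_ideal V V :: (('v \<Rightarrow>\<^sub>0 nat) \<Rightarrow>\<^sub>0 'k::field) set)"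
    by (simp add: var_ideal_all_iff)
  ultimately show "carrier ?R \<noteq> var_ideal V V" by blast
qed (auto simp: var_ideal_all_iff lookup_mult_0 mpoly_ring_simps)

section \<open>Cover ideals\<close>

definition vertex_cover :: "'v set set \<Rightarrow> 'v set \<Rightarrow> bool" where
  "vertex_cover E A \<longleftrightarrow> (\<forall>e\<in>E. A \<inter> e \<noteq> {})"

lemma vertex_cover_mono: "vertex_cover E A \<Longrightarrow> A \<subseteq> B \<Longrightarrow> vertex_cover E B"
  unfolding vertex_cover_def by blast

lemma cover_ideal_eq_monomial_ideal:
  assumes "\<Union>E \<subseteq> V"
  shows "cover_ideal V E = monomial_ideal V (\<lambda>k. vertex_cover E (Poly_Mapping.keys k))"
proof -
  have "var_ideal V e = monomial_ideal V (\<lambda>k. Poly_Mapping.keys k \<inter> e \<noteq> {})" if "e \<in> E" for e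
    using that assms by (intro var_ideal_eq_monomial_ideal) blast
  then show ?thesis
    by (auto simp: cover_ideal_def monomial_ideal_def vertex_cover_def)
qed

lemma ideal_cover_ideal:
  assumes "\<Union>E \<subseteq> V"
  shows "ideal (cover_ideal V E) (mpoly_ring V)"
  unfolding cover_ideal_eq_monomial_ideal[OF assms]
  by (rule ideal_monomial_ideal) (auto elim: vertex_cover_mono)

text \<open>Monomials of a product are products of monomials of the factors, and sums create no new
  ones. This bounds the square of the cover ideal from above.\<close>

lemma keys_cover_ideal_square:
  fixes p :: "('v \<Rightarrow>\<^sub>0 nat) \<Rightarrow>\<^sub>0 'k::field"
  assumes "\<Union>E \<subseteq> V"
    and "p \<in> cover_ideal V E \<cdot>\<^bsub>mpoly_ring V\<^esub> cover_ideal V E"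
    and "k \<in> Poly_Mapping.keys p"
  obtains a b where "k = a + b" "vertex_cover E (Poly_Mapping.keys a)"
    "vertex_cover E (Poly_Mapping.keys b)"
proof -
  have "\<forall>k\<in>Poly_Mapping.keys p. \<exists>a b. k = a + b \<and>
      vertex_cover E (Poly_Mapping.keys a) \<and> vertex_cover E (Poly_Mapping.keys b)"
    using assms(2)
  proof induction
    case (prod i j)
    show ?case
    proof
      fix k assume "k \<in> Poly_Mapping.keys (i \<otimes>\<^bsub>mpoly_ring V\<^esub> j)"
      then obtain a b where "k = a + b" "a \<in> Poly_Mapping.keys i" "b \<in> Poly_Mapping.keys j"
        using keys_mult[of i j] by (auto simp: mpoly_ring_simps)
      then show "\<exists>a b. k = a + b \<and>
          vertex_cover E (Poly_Mapping.keys a) \<and> vertex_cover E (Poly_Mapping.keys b)"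
        using prod by (auto simp: cover_ideal_eq_monomial_ideal[OF assms(1)] monomial_ideal_def)
    qed
  next
    case (sum s1 s2)
    then show ?case
      using keys_add[of s1 s2] by (auto simp: mpoly_ring_simps)
  qed
  with assms(3) that show thesis by blast
qed

lemma single_in_cover_ideal_square:
  assumes "\<Union>E \<subseteq> V"
    and "Poly_Mapping.keys a \<subseteq> V" "vertex_cover E (Poly_Mapping.keys a)"
    and "Poly_Mapping.keys b \<subseteq> V" "vertex_cover E (Poly_Mapping.keys b)"
  shows "Poly_Mapping.single (a + b) (1 :: 'k::field)
    \<in> cover_ideal V E \<cdot>\<^bsub>mpoly_ring V\<^esub> cover_ideal V E"
proof -
  have "Poly_Mapping.single k (1 :: 'k) \<in> cover_ideal V E"
    if "Poly_Mapping.keys k \<subseteq> V" "vertex_cover E (Poly_Mapping.keys k)" for k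
    using that by (simp add: cover_ideal_eq_monomial_ideal[OF assms(1)] monomial_ideal_def
        carrier_mpoly_ring)
  from ideal_prod.prod[OF this[OF assms(2,3)] this[OF assms(4,5)], of "mpoly_ring V"]
  show ?thesis by (simp add: mpoly_ring_simps mult_single)
qed

text \<open>The exponent vector of a squarefree monomial. For infinite \<open>A\<close> the sum
  defaults to \<open>0\<close>, hence the finiteness assumptions below.\<close>

definition set_monomial :: "'v set \<Rightarrow> 'v \<Rightarrow>\<^sub>0 nat" where
  "set_monomial A = (\<Sum>x\<in>A. Poly_Mapping.single x 1)"

lemma lookup_set_monomial:
  "finite A \<Longrightarrow> Poly_Mapping.lookup (set_monomial A) x = (if x \<in> A then 1 else 0)"
  by (simp add: set_monomial_def lookup_sum lookup_single when_def)

lemma keys_set_monomial: "finite A \<Longrightarrow> Poly_Mapping.keys (set_monomial A) = A"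
  by (auto simp: in_keys_iff lookup_set_monomial split: if_splits)

lemma set_monomial_Diff:
  "finite B \<Longrightarrow> A \<subseteq> B \<Longrightarrow> set_monomial A + set_monomial (B - A) = set_monomial B"
  by (simp add: set_monomial_def sum.subset_diff[of A B] add.commute)

theorem theorem2p8:
  fixes V :: "'v set" and E :: "'v set set"
  assumes "hypergraph V E"
    and no_isolated_vertices: "\<Union>E = V"
    and "\<exists>V' E'. shadow V' E' V E \<and> (\<exists>n\<ge>1. odd_cycle n V' E')"
  shows "(var_ideal V V :: (('v \<Rightarrow>\<^sub>0 nat) \<Rightarrow>\<^sub>0 'k::field) set)
    \<in> ass (mpoly_ring V) (cover_ideal V E \<cdot>\<^bsub>mpoly_ring V\<^esub> cover_ideal V E)"
proof -
  let ?R = "mpoly_ring V :: (('v \<Rightarrow>\<^sub>0 nat) \<Rightarrow>\<^sub>0 'k::field) ring"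
  let ?I = "cover_ideal V E \<cdot>\<^bsub>?R\<^esub> cover_ideal V E"
  interpret cring ?R by (rule cring_mpoly_ring)
  obtain V' E' n where sh: "shadow V' E' V E" and cyc: "odd_cycle n V' E'"
    using assms(3) by blast
  have edges: "\<Union>E \<subseteq> V" and fin: "finite V"
    using assms(1) by (auto simp: hypergraph_def)
  have V': "V' \<subseteq> V" and E': "E' = (\<lambda>e. e \<inter> V') ` E" and card: "card E' = card E"
    using sh unfolding shadow_def by blast+
  have "finite E"
    using fin edges by (meson finite_UnionD finite_subset)
  \<comment> \<open>Equal cardinality means that distinct edges have distinct traces on
    \<open>V'\<close>; so exactly one edge of \<open>E\<close> corresponds to the deleted cycle
    edge.\<close>
  then have inj: "inj_on (\<lambda>e. e \<inter> V') E"
    using E' card by (simp add: eq_card_imp_inj_on)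
  have finV': "finite V'" using V' fin by (rule finite_subset)
  have idI: "ideal ?I ?R"
    by (intro ideal_prod_is_ideal ideal_cover_ideal edges)
  define \<mu> where "\<mu> = set_monomial V'"
  define m where "m = Poly_Mapping.single \<mu> (1 :: 'k)"
  have keys_\<mu>: "Poly_Mapping.keys \<mu> = V'"
    by (simp add: \<mu>_def keys_set_monomial finV')
  have m: "m \<in> carrier ?R"
    using V' by (simp add: carrier_mpoly_ring m_def keys_\<mu>)
  have Ann: "Ann_quot ?R ?I (?I +>\<^bsub>?R\<^esub> m) = {r \<in> carrier ?R. r \<otimes>\<^bsub>?R\<^esub> m \<in> ?I}"
    by (rule Ann_quot_coset[OF idI m])
  have "mpoly_var v \<otimes>\<^bsub>?R\<^esub> m \<in> ?I" if v: "v \<in> V" for v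
  proof -
    \<comment> \<open>For an isolated \<open>v\<close> no such edge exists, and its variable would
      be a nonzerodivisor modulo the square of the cover ideal.\<close>
    obtain e where e: "e \<in> E" "v \<in> e" using v no_isolated_vertices by blast
    obtain A where A: "A \<subseteq> V'" and cov: "\<And>e'. e' \<in> E' \<Longrightarrow> e' \<inter> A \<noteq> {}"
      and cov': "\<And>e'. e' \<in> E' \<Longrightarrow> e' \<noteq> e \<inter> V' \<Longrightarrow> \<not> e' \<subseteq> A"
      using odd_cycle_delete_edge_bipartite[OF cyc, of "e \<inter> V'"] e E' by blast
    define a where "a = set_monomial A"
    \<comment> \<open>The vertex \<open>v\<close> may already lie in \<open>V'\<close>, so it is
      added as an exponent and not as a set element; \<open>a + b\<close> then has the right
      multiplicity in every case.\<close>
    define b where "b = set_monomial (V' - A) + Poly_Mapping.single v 1"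
    have keys_a: "Poly_Mapping.keys a = A"
      unfolding a_def using A finV' by (intro keys_set_monomial) (rule finite_subset)
    have keys_b: "Poly_Mapping.keys b = insert v (V' - A)"
      using finV' by (auto simp: b_def keys_set_monomial)
    have "vertex_cover E A"
      using cov A E' unfolding vertex_cover_def by blast
    moreover have "vertex_cover E (insert v (V' - A))"
      unfolding vertex_cover_def
    proof
      fix f assume f: "f \<in> E"
      show "insert v (V' - A) \<inter> f \<noteq> {}"
      proof (cases "f = e")
        case False
        then have "f \<inter> V' \<noteq> e \<inter> V'" using inj e f by (auto dest: inj_onD)
        then show ?thesis using cov'[of "f \<inter> V'"] f E' by blast
      qed (use e in auto)
    qed
    ultimately have "Poly_Mapping.single (a + b) 1 \<in> ?I"
      using A V' v by (intro single_in_cover_ideal_square edges) (auto simp: keys_a keys_b)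
    moreover have "a + b = \<mu> + Poly_Mapping.single v 1"
      unfolding a_def b_def \<mu>_def set_monomial_Diff[OF finV' A, symmetric]
      by (simp only: add.assoc)
    ultimately show ?thesis
      by (simp add: mpoly_var_def m_def mpoly_ring_simps mult_single add.commute)
  qed
  then have "mpoly_var ` V \<subseteq> {r \<in> carrier ?R. r \<otimes>\<^bsub>?R\<^esub> m \<in> ?I}"
    using mpoly_var_in_carrier[of V V] by blast
  then have sub: "var_ideal V V \<subseteq> {r \<in> carrier ?R. r \<otimes>\<^bsub>?R\<^esub> m \<in> ?I}"
    unfolding var_ideal_def by (rule genideal_minimal[OF colon_ideal[OF idI m]])
  have "r \<in> var_ideal V V" if r: "r \<in> carrier ?R" "r \<otimes>\<^bsub>?R\<^esub> m \<in> ?I" for r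
  proof (rule ccontr)
    assume "r \<notin> var_ideal V V"
    then have "Poly_Mapping.lookup r 0 \<noteq> 0"
      using r by (simp add: var_ideal_all_iff)
    \<comment> \<open>The coefficient of \<open>\<mu>\<close> in the product is the constant term of
      \<open>r\<close>.\<close>
    then have "\<mu> \<in> Poly_Mapping.keys (r \<otimes>\<^bsub>?R\<^esub> m)"
      using lookup_mult_single[of r \<mu> 1 0] by (simp add: in_keys_iff mpoly_ring_simps m_def)
    from keys_cover_ideal_square[OF edges r(2) this]
    obtain a b where ab: "\<mu> = a + b" "vertex_cover E (Poly_Mapping.keys a)"
      "vertex_cover E (Poly_Mapping.keys b)" by blast
    have sub: "Poly_Mapping.keys a \<subseteq> V'" "Poly_Mapping.keys b \<subseteq> V'"
      using keys_\<mu> ab(1) by auto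
    \<comment> \<open>As \<open>\<mu>\<close> is squarefree, no variable can occur in both
      factors.\<close>
    have disj: "Poly_Mapping.keys a \<inter> Poly_Mapping.keys b = {}"
    proof -
      have le: "Poly_Mapping.lookup a x + Poly_Mapping.lookup b x \<le> 1" for x
        using lookup_set_monomial[OF finV', of x] ab(1) unfolding \<mu>_def
        by (simp add: lookup_add split: if_splits)
      have "Poly_Mapping.lookup a x = 0 \<or> Poly_Mapping.lookup b x = 0" for x
        using le[of x] by arith
      then show ?thesis
        by (meson disjoint_iff in_keys_iff)
    qed
    \<comment> \<open>If the trace of \<open>e\<close> avoids \<open>a\<close>, then
      \<open>a\<close> does not cover \<open>e\<close>; if it lies inside \<open>a\<close>,
      disjointness shows that \<open>b\<close> does not.\<close>
    obtain e where e: "e \<in> E"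
      "e \<inter> V' \<inter> Poly_Mapping.keys a = {} \<or> e \<inter> V' \<subseteq> Poly_Mapping.keys a"
      using odd_cycle_not_bipartite[OF cyc, of "Poly_Mapping.keys a"] E' by blast
    obtain x y where "x \<in> Poly_Mapping.keys a \<inter> e" "y \<in> Poly_Mapping.keys b \<inter> e"
      using ab(2,3) e(1) unfolding vertex_cover_def by blast
    then show False
      using e(2) sub disj by blast
  qed
  with sub have "var_ideal V V = Ann_quot ?R ?I (?I +>\<^bsub>?R\<^esub> m)"
    unfolding Ann by blast
  moreover have "?I +>\<^bsub>?R\<^esub> m \<in> carrier (?R Quot ?I)"
    using m by (auto simp: FactRing_def A_RCOSETS_def')
  ultimately show ?thesis
    unfolding ass_def using primeideal_var_ideal by blast
qed

end
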